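(* Let $m$ be an integer and let $G$ be a finite group with $|C(G)|=\frac{|G|}{2}+m$. If $p$ is a prime divisor of $|G|$, then $p\leq\mathcal{O}_2(G)+4-2m$.
   Context: For a finite group $G$, $C(G)$ is the set of all cyclic subgroups of $G$ (including the trivial one), and $\mathcal{O}_2(G)$ is the number of elements of order $2$ in $G$. *)

theory Defs
  imports "HOL-Algebra.Elementary_Groups" "HOL-Algebra.Multiplicative_Group"
    "HOL-Computational_Algebra.Primes" Complex_Main
begin

definition cyclic_subgroups :: "('a, 'b) monoid_scheme \<Rightarrow> 'a set set"
  where "cyclic_subgroups G = {H. subgroup H G \<and> cyclic_group (G\<lparr>carrier := H\<rparr>)}"

definition num_involutions :: "('a, 'b) monoid_scheme \<Rightarrow> nat"
  where "num_involutions G = card {x \<in> carrier G. group.ord G x = 2}"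

end

theory Submission
  imports Defs "HOL-Algebra.Sylow"
begin

text \<open>
  Sort the elements of \<open>G\<close> by the cyclic subgroup that they generate. A cyclic subgroup has a
  single generator only if that generator is its own inverse, so \<open>2 |C(G)| \<le> |G| + 1 + O\<^sub>2(G)\<close>.
  A subgroup of order \<open>p\<close>, which exists by Cauchy's theorem, has \<open>p - 1\<close> generators instead of the
  two accounted for, which improves the bound by \<open>p - 3\<close>.
\<close>

context group
begin

text \<open>Exhibits C(G) as the index set of the fibres of
  \<open>\<lambda>x. generate G {x}\<close>. These fibres, the sets of generators, partition the
  carrier and are nonempty.\<close>

lemma cyclic_subgroups_eq_image_generate:
  "cyclic_subgroups G = (\<lambda>x. generate G {x}) ` carrier G"
proof (intro equalityI subsetI)
  fix H assume "H \<in> cyclic_subgroups G"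
  then have H: "subgroup H G" and "cyclic_group (G\<lparr>carrier := H\<rparr>)"
    by (auto simp: cyclic_subgroups_def)
  then obtain x where x: "x \<in> H" and "subgroup_generated (G\<lparr>carrier := H\<rparr>) {x} = G\<lparr>carrier := H\<rparr>"
    by (auto simp: cyclic_group_def)
  \<comment> \<open>The equality of structures matters only through its carriers; generation inside
    \<open>H\<close> is then compared with generation inside \<open>G\<close>.\<close>
  from arg_cong[OF this(2), of carrier] x have "generate (G\<lparr>carrier := H\<rparr>) {x} = H"
    by (simp add: carrier_subgroup_generated)
  moreover have "generate (G\<lparr>carrier := H\<rparr>) {x} = generate G {x}"
    using x H by (intro generate_consistent) auto
  ultimately show "H \<in> (\<lambda>x. generate G {x}) ` carrier G"
    using subgroup.mem_carrier[OF H x] by auto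
next
  fix H assume "H \<in> (\<lambda>x. generate G {x}) ` carrier G"
  then obtain x where x: "x \<in> carrier G" and H: "H = generate G {x}"
    by auto
  have "G\<lparr>carrier := H\<rparr> = subgroup_generated G {x}"
    using x H by (simp add: subgroup_generated_def)
  moreover have "subgroup H G"
    using x H by (simp add: generate_is_subgroup)
  ultimately show "H \<in> cyclic_subgroups G"
    using cyclic_group_generated[of x] by (simp add: cyclic_subgroups_def)
qed

lemma generate_inv_singleton:
  assumes "x \<in> carrier G"
  shows "generate G {inv x} = generate G {x}"
proof -
  have "generate G {inv y} \<subseteq> generate G {y}" if "y \<in> carrier G" for y
    using that generate_is_subgroup[of "{y}"]
    by (intro generate_subgroup_incl) (auto intro: generate.inv)
  from this[OF assms] this[of "inv x"] assms show ?thesis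
    by auto
qed

lemma generate_eq_prime_subgroup:
  assumes "subgroup H G" "prime (card H)" "x \<in> H" "x \<noteq> \<one>"
  shows "generate G {x} = H"
proof -
  have x: "x \<in> carrier G"
    using subgroup.mem_carrier[OF assms(1,3)] .
  have fin: "finite H"
    using assms(2) by (intro card_ge_0_finite prime_gt_0_nat)
  have sub: "generate G {x} \<subseteq> H"
    using assms by (intro generate_subgroup_incl) auto
  interpret H: group "G\<lparr>carrier := H\<rparr>"
    using assms(1) by (rule subgroup_imp_group)
  \<comment> \<open>Lagrange inside \<open>H\<close>: the order of \<open>x\<close> divides a prime
    and is not 1, so \<open>x\<close> already generates a subgroup as large as
    \<open>H\<close>.\<close>
  have "x [^] card H = \<one>"
    using H.pow_order_eq_1[of x] assms(3) by (simp add: order_def nat_pow_consistent[symmetric])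
  then have "ord x dvd card H"
    using x pow_eq_id by blast
  moreover have "ord x \<noteq> 1"
    using x assms(4) ord_eq_1 by simp
  ultimately have "ord x = card H"
    using assms(2) unfolding prime_nat_iff by blast
  then show ?thesis
    using sub fin x generate_pow_card[of x] by (intro card_subset_eq) auto
qed

lemma generators_prime_subgroup:
  assumes "subgroup H G" "prime (card H)"
  shows "{x \<in> carrier G. generate G {x} = H} = H - {\<one>}"
proof -
  have "x \<in> generate G {x}" for x
    by (simp add: generate.incl)
  moreover have "H \<noteq> {\<one>}"
    using assms(2) by auto
  ultimately show ?thesis
    using generate_eq_prime_subgroup[OF assms] generate_one subgroup.mem_carrier[OF assms(1)]
    by auto
qed

text \<open>The generators of a subgroup are closed under inversion, so a sole generator satisfies
  \<open>inv x = x\<close> and squares to \<open>\<one>\<close>.\<close>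

lemma ord_le_2_of_unique_generator:
  assumes "x \<in> carrier G" "card {y \<in> carrier G. generate G {y} = generate G {x}} = 1"
  shows "ord x = 1 \<or> ord x = 2"
proof -
  have "inv x = x"
    using assms generate_inv_singleton[OF assms(1)] inv_closed[OF assms(1)]
    by (elim card_1_singletonE) (blast dest: equalityD1)
  then have "x [^] (2::nat) = \<one>"
    using assms(1) r_inv[of x] by (simp add: numeral_2_eq_2)
  then have "ord x dvd 2"
    using assms(1) pow_eq_id by blast
  then show ?thesis
    using prime_nat_iff[of 2] by auto
qed

lemma card_uniquely_generated_le:
  assumes "finite (carrier G)"
  shows "card {H \<in> cyclic_subgroups G. card {x \<in> carrier G. generate G {x} = H} = 1}
    \<le> 1 + num_involutions G" (is "card ?A \<le> _")
proof -
  let ?I = "{x \<in> carrier G. ord x = 2}"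
  \<comment> \<open>Covering by the subgroups generated by \<open>\<one>\<close> and by the
    involutions suffices, since only an upper bound is wanted.\<close>
  have "?A \<subseteq> (\<lambda>x. generate G {x}) ` (insert \<one> ?I)"
  proof
    fix H assume H: "H \<in> ?A"
    then obtain x where "x \<in> carrier G" "H = generate G {x}"
      by (auto simp: cyclic_subgroups_eq_image_generate)
    with H ord_le_2_of_unique_generator[of x] ord_eq_1[of x] have "x \<in> insert \<one> ?I"
      by auto
    with \<open>H = generate G {x}\<close> show "H \<in> (\<lambda>x. generate G {x}) ` (insert \<one> ?I)"
      by blast
  qed
  then have "card ?A \<le> card (insert \<one> ?I)"
    using assms by (intro surj_card_le) auto
  also have "\<dots> \<le> 1 + num_involutions G"
    unfolding num_involutions_def using card_insert_le_m1[of _ ?I] assms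
    by (simp add: card_insert_if)
  finally show ?thesis .
qed

lemma card_cyclic_subgroups_prime_bound:
  assumes fin: "finite (carrier G)" and p: "prime p" "p dvd order G"
  shows "2 * card (cyclic_subgroups G) + p \<le> order G + num_involutions G + 4"
proof -
  let ?C = "cyclic_subgroups G"
  let ?gens = "\<lambda>H. {x \<in> carrier G. generate G {x} = H}"
  let ?A = "{H \<in> ?C. card (?gens H) = 1}"
  note C = cyclic_subgroups_eq_image_generate
  have finC: "finite ?C"
    using fin by (simp add: C)
  \<comment> \<open>With exponent 1, and without asking that \<open>p\<close> and \<open>m\<close>
    be coprime, Sylow's theorem becomes Cauchy's theorem.\<close>
  obtain m where "order G = p ^ 1 * m"
    using p(2) by auto
  from sylow_thm[OF p(1) is_group this fin] obtain K where K: "subgroup K G" "card K = p"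
    by auto
  have finK: "finite K"
    using K(1) fin by (meson finite_subset subgroup.subset)
  have gensK: "card (?gens K) = p - 1"
    using generators_prime_subgroup[of K] K p(1) finK subgroup.one_closed[OF K(1)]
    by simp
  then have "?gens K \<noteq> {}"
    using p(1) prime_gt_1_nat[of p] by (metis card.empty less_irrefl zero_less_diff)
  then have KC: "K \<in> ?C"
    by (auto simp: C)
  \<comment> \<open>The indicator of \<open>?A\<close> makes up for the missing generator when a
    fibre is a singleton.\<close>
  have general: "2 \<le> card (?gens H) + of_bool (H \<in> ?A)" if "H \<in> ?C" for H
  proof -
    have "?gens H \<noteq> {}"
      using that by (auto simp: C)
    then have "card (?gens H) > 0"
      using fin by (simp add: card_gt_0_iff)
    then show ?thesis
      using that by auto
  qed
  \<comment> \<open>Subtraction is truncated: for p = 2 and p = 3 the extra term is 0 and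
    \<open>general\<close> suffices. For p > 3 the fibre of \<open>K\<close> has p - 1 = 2 + (p - 3)
    elements.\<close>
  have "2 + (if H = K then p - 3 else 0) \<le> card (?gens H) + of_bool (H \<in> ?A)"
    if "H \<in> ?C" for H
  proof (cases "H = K \<and> p > 3")
    case True
    then have "2 + (p - 3) = p - 1"
      by arith
    with True show ?thesis
      using gensK by simp
  next
    case False
    then have "(if H = K then p - 3 else 0) = 0"
      by auto
    then show ?thesis
      using general[OF that] by simp
  qed
  then have "(\<Sum>H\<in>?C. 2 + (if H = K then p - 3 else 0))
      \<le> (\<Sum>H\<in>?C. card (?gens H) + of_bool (H \<in> ?A))"
    by (rule sum_mono)
  moreover have "(\<Sum>H\<in>?C. 2 + (if H = K then p - 3 else 0)) = 2 * card ?C + (p - 3)"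
    using finC KC by (subst sum.distrib) simp
  \<comment> \<open>The elements of \<open>G\<close> counted fibre by fibre.\<close>
  moreover have "(\<Sum>H\<in>?C. card (?gens H)) = order G"
    using sum.image_gen[OF fin, of "\<lambda>_. 1::nat" "\<lambda>x. generate G {x}"]
    by (simp add: C order_def)
  moreover have "(\<Sum>H\<in>?C. of_bool (H \<in> ?A)) = card ?A"
    using finC by (simp add: of_bool_def sum.If_cases Int_def)
  ultimately have "2 * card ?C + (p - 3) \<le> order G + card ?A"
    by (simp only: sum.distrib)
  \<comment> \<open>The constant 4 is 3 + 1: p \<le> (p - 3) + 3 holds even when the subtraction
    truncates, and the 1 comes from the trivial subgroup in \<open>?A\<close>.\<close>
  then show ?thesis
    using card_uniquely_generated_le[OF fin] by linarith
qed

end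

theorem lemma1p6:
  fixes G :: "('a, 'b) monoid_scheme" and m :: int and p :: nat
  assumes "group G" and "finite (carrier G)"
    and "real (card (cyclic_subgroups G)) = real (order G) / 2 + real_of_int m"
    and "prime p" and "p dvd order G"
  shows "int p \<le> int (num_involutions G) + 4 - 2 * m"
proof -
  \<comment> \<open>Doubling removes the real division, so that the hypothesis becomes an equation
    between integers.\<close>
  have "real_of_int (2 * int (card (cyclic_subgroups G))) = real_of_int (int (order G) + 2 * m)"
    using assms(3) by simp
  then have "2 * int (card (cyclic_subgroups G)) = int (order G) + 2 * m"
    by (simp only: of_int_eq_iff)
  moreover have "2 * card (cyclic_subgroups G) + p \<le> order G + num_involutions G + 4"
    using group.card_cyclic_subgroups_prime_bound assms by blast
  ultimately show ?thesis
    by linarith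
qed

end
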